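(* Let $d\ge 2$ be an integer and $1\le p<d$. There is a constant $C$ depending only on $d$ and $p$ such that for every $\tau>0$ and every smooth compactly supported function $u$ on $\Sigma_\tau\cong\mathbb{R}^d$, $$\tau^{1/d}\,\|u\|_{\mathcal{L}^{dp/(d-p)}_1}\le C\,\|u\|_{\mathring{\mathcal{W}}^{1,p}_{1-p}}.$$
   Context: For $\tau>0$ let $\Sigma_\tau=\{(t,x)\in\mathbb{R}^{1+d}: t^2-|x|^2=\tau^2,\ t>0\}$, parametrized by $x\in\mathbb{R}^d$ via $x\mapsto(\sqrt{\tau^2+|x|^2},x)$, and let $w_\tau(x)=\sqrt{\tau^2+|x|^2}$. The induced volume form is $\mathrm{dvol}=\frac{\tau}{w_\tau}\,dx^1\cdots dx^d$. The Lorentz boosts $L^i=x^i\partial_t+t\partial_{x^i}$ are tangent to $\Sigma_\tau$ and act there as $L^i=w_\tau\partial_{x^i}$. For $p\in[1,\infty)$, $\alpha\in\mathbb{R}$, $k\in\mathbb{N}$: $\|u\|_{\mathcal{L}^p_\alpha}=\left(\int_{\Sigma_\tau} w_\tau^\alpha|u|^p\,\mathrm{dvol}\right)^{1/p}$ and $\|u\|_{\mathring{\mathcal{W}}^{k,p}_\alpha}=\sum_{i_1,\dots,i_k=1}^d\|L^{i_1}\cdots L^{i_k}u\|_{\mathcal{L}^p_\alpha}$. *)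

theory Defs
  imports "HOL-Analysis.Analysis"
begin

definition hyperboloid :: "real \<Rightarrow> (real \<times> (real ^ 'n)) set" where
  "hyperboloid \<tau> = {(t, x). t\<^sup>2 - (norm x)\<^sup>2 = \<tau>\<^sup>2 \<and> t > 0}"

definition hyp_weight :: "real \<Rightarrow> real ^ 'n \<Rightarrow> real" where
  "hyp_weight \<tau> x = sqrt (\<tau>\<^sup>2 + (norm x)\<^sup>2)"

text \<open>Functions on the hyperboloid are represented by their pullbacks to \<open>\<real>\<^sup>d\<close> along the
  following global chart; the measure, the boosts and the norms below are all written in it.\<close>

lemma hyperboloid_param:
  assumes "\<tau> > 0"
  shows "bij_betw (\<lambda>x. (hyp_weight \<tau> x, x)) (UNIV :: (real ^ 'n) set) (hyperboloid \<tau>)"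
proof (rule bij_betw_byWitness[where f' = snd])
  have pos: "\<tau>\<^sup>2 + (norm x)\<^sup>2 > 0" for x :: "real ^ 'n"
    using assms by (simp add: add_pos_nonneg)
  show "(\<lambda>x. (hyp_weight \<tau> x, x)) ` (UNIV :: (real ^ 'n) set) \<subseteq> hyperboloid \<tau>"
    using pos by (auto simp: hyperboloid_def hyp_weight_def less_imp_le)
  show "\<forall>y\<in>(hyperboloid \<tau> :: (real \<times> (real ^ 'n)) set). (hyp_weight \<tau> (snd y), snd y) = y"
  proof (clarsimp simp: hyperboloid_def hyp_weight_def)
    fix t and x :: "real ^ 'n"
    assume "t\<^sup>2 - (norm x)\<^sup>2 = \<tau>\<^sup>2" "t > 0"
    then have "\<tau>\<^sup>2 + (norm x)\<^sup>2 = t\<^sup>2" by linarith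
    then show "sqrt (\<tau>\<^sup>2 + (norm x)\<^sup>2) = t" using \<open>t > 0\<close> by simp
  qed
qed auto

definition hyp_vol :: "real \<Rightarrow> (real ^ 'n) measure" where
  "hyp_vol \<tau> = density lborel (\<lambda>x. ennreal (\<tau> / hyp_weight \<tau> x))"

definition boost :: "real \<Rightarrow> 'n \<Rightarrow> (real ^ 'n \<Rightarrow> real) \<Rightarrow> (real ^ 'n \<Rightarrow> real)" where
  "boost \<tau> i u = (\<lambda>x. hyp_weight \<tau> x * frechet_derivative u (at x) (axis i 1))"

text \<open>The integral is the Bochner integral, which is 0 for non-integrable integrands; the norm is
  only applied to continuous, compactly supported functions and \<open>p \<ge> 1\<close>.\<close>

definition Lp_norm :: "real \<Rightarrow> real \<Rightarrow> real \<Rightarrow> (real ^ 'n \<Rightarrow> real) \<Rightarrow> real" where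
  "Lp_norm \<tau> \<alpha> p u =
     (LINT x|hyp_vol \<tau>. hyp_weight \<tau> x powr \<alpha> * \<bar>u x\<bar> powr p) powr (1 / p)"

text \<open>The lists of length \<open>k\<close> are the index tuples \<open>(i\<^sub>1, \<dots>, i\<^sub>k)\<close>; \<open>foldr\<close> applies the last boost first.\<close>

definition Wkp_homog_norm ::
    "real \<Rightarrow> real \<Rightarrow> nat \<Rightarrow> real \<Rightarrow> (real ^ 'n \<Rightarrow> real) \<Rightarrow> real" where
  "Wkp_homog_norm \<tau> \<alpha> k p u =
     (\<Sum>js | length js = k. Lp_norm \<tau> \<alpha> p (foldr (boost \<tau>) js u))"

fun Ck :: "nat \<Rightarrow> (real ^ 'n \<Rightarrow> real) \<Rightarrow> bool" where
  "Ck 0 u \<longleftrightarrow> continuous_on UNIV u"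
| "Ck (Suc k) u \<longleftrightarrow> (\<forall>x. u differentiable (at x)) \<and>
     (\<forall>v. Ck k (\<lambda>x. frechet_derivative u (at x) v))"

definition smooth :: "(real ^ 'n \<Rightarrow> real) \<Rightarrow> bool" where
  "smooth u \<longleftrightarrow> (\<forall>k. Ck k u)"

definition compactly_supported :: "(real ^ 'n \<Rightarrow> real) \<Rightarrow> bool" where
  "compactly_supported u \<longleftrightarrow> compact (closure (support_on UNIV u))"

end

theory Submission
  imports Defs
begin

text \<open>
  The weights are chosen so that they cancel exactly. In the chart \<open>x\<close> the boost is
  \<open>L\<^sup>i = w \<partial>\<^sub>i\<close> and the volume form is \<open>(\<tau> / w) dx\<close>, so \<open>w\<^bsup>1-p\<^esup> \<bar>L\<^sup>i u\<bar>\<^sup>p dvol = \<tau> \<bar>\<partial>\<^sub>i u\<bar>\<^sup>p dx\<close> and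
  \<open>w \<bar>u\<bar>\<^bsup>q\<^esup> dvol = \<tau> \<bar>u\<bar>\<^bsup>q\<^esup> dx\<close> with \<open>q = dp/(d-p)\<close>. As \<open>1/d + 1/q = 1/p\<close>, both sides of the assertion carry
  the same factor \<open>\<tau>\<^bsup>1/p\<^esup>\<close>, and what remains is the Gagliardo--Nirenberg--Sobolev inequality on \<open>\<real>\<^sup>d\<close>
  (\<open>Gagliardo_Nirenberg_Sobolev\<close>), where \<open>\<tau>\<close> no longer occurs.

  That inequality is proved by the classical argument. For \<open>p = 1\<close> (\<open>Sobolev_L1\<close>) the function is bounded
  at each point by the integral of \<open>\<Sum>\<^sub>i \<bar>\<partial>\<^sub>i u\<bar>\<close> along each of the \<open>d\<close> lines through the point that are parallel to the axes,
  and the product of the \<open>d\<close> line integrals, to the power \<open>1/(d-1)\<close>, is integrated by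
  induction on the number of variables (\<open>integral_prod_line_integrals_le\<close>). For \<open>p > 1\<close> the case
  \<open>p = 1\<close> is applied to a power of \<open>\<bar>u\<bar>\<close>, followed by Hoelder's inequality.

  Since \<open>u\<close> has compact support, Lebesgue measure can be replaced by a product of finite measures
  (\<open>integral_of_coords\<close>). All functions in the induction are then bounded on a finite measure space, so
  real-valued integrals suffice, and powers of extended reals are avoided.
\<close>

section \<open>Bounded nonnegative measurable functions\<close>

text \<open>On finite measures these functions are integrable, and the class is closed under products,
  nonnegative powers and partial integrals; this settles all integrability questions in the iterated
  use of Fubini's theorem below. Signs and bounds are required only on the space of the measure, so
  that functions on a product need no control outside its extensional arguments.\<close>

definition bounded_nonneg :: "'a measure \<Rightarrow> ('a \<Rightarrow> real) \<Rightarrow> bool" where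
  "bounded_nonneg N f \<longleftrightarrow>
     f \<in> borel_measurable N \<and> (\<exists>B. \<forall>x\<in>space N. 0 \<le> f x \<and> f x \<le> B)"

lemma bounded_nonnegI:
  "f \<in> borel_measurable N \<Longrightarrow> (\<And>x. x \<in> space N \<Longrightarrow> 0 \<le> f x) \<Longrightarrow>
    (\<And>x. x \<in> space N \<Longrightarrow> f x \<le> B) \<Longrightarrow> bounded_nonneg N f"
  unfolding bounded_nonneg_def by blast

lemma bounded_nonneg_measurable: "bounded_nonneg N f \<Longrightarrow> f \<in> borel_measurable N"
  and bounded_nonneg_nonneg: "bounded_nonneg N f \<Longrightarrow> x \<in> space N \<Longrightarrow> 0 \<le> f x"
  by (auto simp: bounded_nonneg_def)

lemma bounded_nonneg_integrable:
  assumes "finite_measure N" "bounded_nonneg N f" shows "integrable N f"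
proof -
  interpret finite_measure N by fact
  obtain B where "\<forall>x\<in>space N. 0 \<le> f x \<and> f x \<le> B" "f \<in> borel_measurable N"
    using assms(2) by (auto simp: bounded_nonneg_def)
  then show ?thesis by (intro integrable_const_bound[where B = B] AE_I2) auto
qed

lemma bounded_nonneg_mult:
  assumes "bounded_nonneg N f" "bounded_nonneg N g"
  shows "bounded_nonneg N (\<lambda>x. f x * g x)"
proof -
  obtain B C where "\<forall>x\<in>space N. 0 \<le> f x \<and> f x \<le> B" "\<forall>x\<in>space N. 0 \<le> g x \<and> g x \<le> C"
    using assms by (auto simp: bounded_nonneg_def)
  then show ?thesis
    using assms[THEN bounded_nonneg_measurable]
    by (intro bounded_nonnegI[where B = "B * C"]) (auto intro!: mult_mono intro: order_trans)
qed

lemma bounded_nonneg_const: "0 \<le> c \<Longrightarrow> bounded_nonneg N (\<lambda>x. c)"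
  by (rule bounded_nonnegI[where B = c]) auto

lemma bounded_nonneg_prod:
  assumes "\<And>i. i \<in> I \<Longrightarrow> bounded_nonneg N (f i)"
  shows "bounded_nonneg N (\<lambda>x. \<Prod>i\<in>I. f i x)"
  using assms
  by (induction I rule: infinite_finite_induct) (auto intro: bounded_nonneg_mult bounded_nonneg_const)

lemma bounded_nonneg_powr:
  assumes "bounded_nonneg N f" "0 \<le> a"
  shows "bounded_nonneg N (\<lambda>x. f x powr a)"
proof -
  obtain B where "\<forall>x\<in>space N. 0 \<le> f x \<and> f x \<le> B"
    using assms by (auto simp: bounded_nonneg_def)
  then show ?thesis
    using assms bounded_nonneg_measurable[OF assms(1)]
    by (intro bounded_nonnegI[where B = "B powr a"]) (auto intro!: powr_mono2)
qed

lemma bounded_nonneg_compose: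
  assumes "bounded_nonneg N f" "h \<in> measurable K N"
  shows "bounded_nonneg K (\<lambda>x. f (h x))"
  using assms measurable_space[OF assms(2)] unfolding bounded_nonneg_def by force

lemma bounded_nonneg_integral:
  assumes "finite_measure K" "bounded_nonneg (N \<Otimes>\<^sub>M K) (\<lambda>(x, y). g x y)"
  shows "bounded_nonneg N (\<lambda>x. \<integral>y. g x y \<partial>K)"
proof -
  interpret finite_measure K by fact
  obtain B where B: "\<forall>z\<in>space (N \<Otimes>\<^sub>M K). 0 \<le> case_prod g z \<and> case_prod g z \<le> B"
    and [measurable]: "case_prod g \<in> borel_measurable (N \<Otimes>\<^sub>M K)"
    using assms(2) by (auto simp: bounded_nonneg_def)
  show ?thesis
  proof (rule bounded_nonnegI[where B = "measure K (space K) * B"])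
    show "(\<lambda>x. \<integral>y. g x y \<partial>K) \<in> borel_measurable N" by measurable
  next
    fix x assume x: "x \<in> space N"
    have *: "0 \<le> g x y \<and> g x y \<le> B" if "y \<in> space K" for y
      using B x that by (auto simp: space_pair_measure)
    show "0 \<le> (\<integral>y. g x y \<partial>K)"
      using * by (intro Bochner_Integration.integral_nonneg) auto
    have [measurable]: "g x \<in> borel_measurable K" using x by measurable
    have "(\<integral>y. g x y \<partial>K) \<le> (\<integral>y. B \<partial>K)"
      using * by (intro integral_mono integrable_const_bound[where B = B] AE_I2) force+
    then show "(\<integral>y. g x y \<partial>K) \<le> measure K (space K) * B" by simp
  qed
qed

section \<open>Hoelder's inequality\<close>

text \<open>Hoelder's inequality for the conjugate exponents \<open>1 / (1 - \<theta>)\<close> and \<open>1 / \<theta>\<close>, in the form in which the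
  powers sit on the integrands: normalise both integrals to 1 and integrate Young's inequality.\<close>

lemma Holder_powr:
  fixes f g :: "'a \<Rightarrow> real"
  assumes f: "integrable N f" and g: "integrable N g"
    and nonneg: "\<And>x. x \<in> space N \<Longrightarrow> 0 \<le> f x" "\<And>x. x \<in> space N \<Longrightarrow> 0 \<le> g x"
    and \<theta>: "0 < \<theta>" "\<theta> < 1"
  shows "(\<integral>x. f x powr (1 - \<theta>) * g x powr \<theta> \<partial>N)
           \<le> (\<integral>x. f x \<partial>N) powr (1 - \<theta>) * (\<integral>x. g x \<partial>N) powr \<theta>"
proof -
  define F G where "F = (\<integral>x. f x \<partial>N)" and "G = (\<integral>x. g x \<partial>N)"
  have "F \<ge> 0" "G \<ge> 0" unfolding F_def G_def using nonneg by auto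
  show ?thesis
  proof (cases "F = 0 \<or> G = 0")
    case True
    then have "AE x in N. f x = 0 \<or> g x = 0"
    proof
      assume "F = 0"
      then show ?thesis
        using integral_nonneg_eq_0_iff_AE[OF f] nonneg(1) unfolding F_def by auto
    next
      assume "G = 0"
      then show ?thesis
        using integral_nonneg_eq_0_iff_AE[OF g] nonneg(2) unfolding G_def by auto
    qed
    then have "(\<integral>x. f x powr (1 - \<theta>) * g x powr \<theta> \<partial>N) = 0"
      by (intro integral_eq_zero_AE) (auto elim!: eventually_mono)
    then show ?thesis by simp
  next
    case False
    then have pos: "F > 0" "G > 0" using \<open>F \<ge> 0\<close> \<open>G \<ge> 0\<close> by auto
    define c where "c = F powr (1 - \<theta>) * G powr \<theta>"
    have "c > 0" unfolding c_def using pos by simp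
    have young: "f x powr (1 - \<theta>) * g x powr \<theta> \<le> c * ((1 - \<theta>) * (f x / F) + \<theta> * (g x / G))"
      if "x \<in> space N" for x
    proof -
      have "(f x / F) powr (1 - \<theta>) * (g x / G) powr \<theta> \<le> (1 - \<theta>) * (f x / F) + \<theta> * (g x / G)"
      proof (cases "f x = 0 \<or> g x = 0")
        case True
        then show ?thesis using nonneg[OF that] pos \<theta> by auto
      next
        case False
        then show ?thesis
          using Youngs_inequality_0[of "1 - \<theta>" \<theta> "f x / F" "g x / G"] nonneg[OF that] pos \<theta>
          by (simp add: less_le)
      qed
      moreover have "(f x / F) powr (1 - \<theta>) * (g x / G) powr \<theta>
          = (f x powr (1 - \<theta>) * g x powr \<theta>) / c"
        unfolding c_def using nonneg[OF that] pos by (simp add: powr_divide)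
      ultimately show ?thesis using \<open>c > 0\<close> by (simp only: pos_divide_le_eq mult.commute)
    qed
    have int: "integrable N (\<lambda>x. c * ((1 - \<theta>) * (f x / F) + \<theta> * (g x / G)))"
      using f g by auto
    have "(\<integral>x. f x powr (1 - \<theta>) * g x powr \<theta> \<partial>N)
        \<le> (\<integral>x. c * ((1 - \<theta>) * (f x / F) + \<theta> * (g x / G)) \<partial>N)"
    proof (rule integral_mono[OF _ int young])
      show "integrable N (\<lambda>x. f x powr (1 - \<theta>) * g x powr \<theta>)"
        using f g order_trans[OF young abs_ge_self]
        by (intro Bochner_Integration.integrable_bound[OF int] AE_I2) auto
    qed
    also have "\<dots> = c * ((1 - \<theta>) * (F / F) + \<theta> * (G / G))"
      using f g by (simp add: F_def G_def)
    also have "\<dots> = c" using pos by simp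
    finally show ?thesis by (simp add: c_def F_def G_def)
  qed
qed

section \<open>Line integrals on products of finite measures\<close>

locale finite_measure_family =
  fixes M :: "'i \<Rightarrow> 'a measure"
  assumes finite_measures: "\<And>i. finite_measure (M i)"
begin

sublocale product_sigma_finite M
  using finite_measures by (simp add: product_sigma_finite_def finite_measure_def)

lemma finite_measure_PiM:
  assumes "finite J" shows "finite_measure (PiM J M)"
proof
  have "emeasure (M i) (space (M i)) \<noteq> \<infinity>" for i
    using finite_measures finite_measure.emeasure_finite by auto
  then show "emeasure (PiM J M) (space (PiM J M)) \<noteq> \<infinity>"
    using assms by (simp add: space_PiM emeasure_PiM ennreal_prod_eq_top)
qed

lemma bounded_nonneg_line_integral:
  assumes "bounded_nonneg (PiM (insert i J) M) f"
  shows "bounded_nonneg (PiM J M) (\<lambda>x. \<integral>s. f (x(i := s)) \<partial>M i)"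
proof (rule bounded_nonneg_integral[OF finite_measures])
  show "bounded_nonneg (PiM J M \<Otimes>\<^sub>M M i) (\<lambda>(x, s). f (x(i := s)))"
    using bounded_nonneg_compose[OF assms measurable_add_dim] by (simp add: split_def)
qed

lemma bounded_nonneg_slice:
  assumes "bounded_nonneg (PiM (insert i J) M) f" "t \<in> space (M i)"
  shows "bounded_nonneg (PiM J M) (\<lambda>x. f (x(i := t)))"
proof (rule bounded_nonneg_compose[OF assms(1)])
  show "(\<lambda>x. x(i := t)) \<in> measurable (PiM J M) (PiM (insert i J) M)"
    using assms(2) by (intro measurable_fun_upd[where J = J]) auto
qed

lemma bounded_nonneg_slice_integral:
  assumes "finite J" "bounded_nonneg (PiM (insert i J) M) f"
  shows "bounded_nonneg (M i) (\<lambda>t. \<integral>x. f (x(i := t)) \<partial>PiM J M)"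
proof (rule bounded_nonneg_integral[OF finite_measure_PiM[OF assms(1)]])
  have "(\<lambda>z. (snd z)(i := fst z)) \<in> measurable (M i \<Otimes>\<^sub>M PiM J M) (PiM (insert i J) M)"
    by (intro measurable_fun_upd[where J = J]) auto
  from bounded_nonneg_compose[OF assms(2) this]
  show "bounded_nonneg (M i \<Otimes>\<^sub>M PiM J M) (\<lambda>(t, x). f (x(i := t)))"
    by (simp add: split_def)
qed

lemma product_integral_insert_rev:
  assumes J: "finite J" "i \<notin> J" and f: "bounded_nonneg (PiM (insert i J) M) f"
  shows "(\<integral>x. f x \<partial>PiM (insert i J) M) = (\<integral>t. (\<integral>x. f (x(i := t)) \<partial>PiM J M) \<partial>M i)"
proof -
  interpret J: finite_measure "PiM J M" by (rule finite_measure_PiM[OF J(1)])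
  interpret i: finite_measure "M i" by (rule finite_measures)
  interpret P: pair_sigma_finite "PiM J M" "M i" ..
  interpret PF: finite_measure "PiM J M \<Otimes>\<^sub>M M i" 
    by (rule finite_measure_pair_measure) unfold_locales
  have "bounded_nonneg (PiM J M \<Otimes>\<^sub>M M i) (\<lambda>(x, s). f (x(i := s)))"
    using bounded_nonneg_compose[OF f measurable_add_dim] by (simp add: split_def)
  then have int: "integrable (PiM J M \<Otimes>\<^sub>M M i) (\<lambda>(x, s). f (x(i := s)))"
    by (rule bounded_nonneg_integrable[OF PF.finite_measure_axioms])
  have "(\<integral>x. f x \<partial>PiM (insert i J) M) = (\<integral>x. (\<integral>t. f (x(i := t)) \<partial>M i) \<partial>PiM J M)"
    using f J by (intro product_integral_insert bounded_nonneg_integrable finite_measure_PiM) auto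
  also have "\<dots> = (\<integral>t. (\<integral>x. f (x(i := t)) \<partial>PiM J M) \<partial>M i)"
    using P.Fubini_integral[OF int] by simp
  finally show ?thesis .
qed

text \<open>Fubini's theorem in the order that puts the distinguished coordinate outermost reduces an
  inequality of integrals to one on each slice, provided that the factor \<open>c\<close> is the same for all slices.\<close>

lemma integral_le_by_slices:
  assumes J: "finite J" "k \<notin> J"
    and f: "bounded_nonneg (PiM (insert k J) M) f" and h: "bounded_nonneg (PiM (insert k J) M) h"
    and slice: "\<And>t. t \<in> space (M k) \<Longrightarrow>
      (\<integral>x. h (x(k := t)) \<partial>PiM J M) \<le> (\<integral>x. f (x(k := t)) \<partial>PiM J M) * c"
  shows "(\<integral>x. h x \<partial>PiM (insert k J) M) \<le> (\<integral>x. f x \<partial>PiM (insert k J) M) * c"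
proof -
  note int = bounded_nonneg_integrable[OF finite_measures bounded_nonneg_slice_integral[OF J(1)]]
  have "(\<integral>t. (\<integral>x. h (x(k := t)) \<partial>PiM J M) \<partial>M k) \<le> (\<integral>t. (\<integral>x. f (x(k := t)) \<partial>PiM J M) * c \<partial>M k)"
    by (intro integral_mono int integrable_mult_left f h slice)
  then show ?thesis
    by (simp add: product_integral_insert_rev[OF J f] product_integral_insert_rev[OF J h])
qed

text \<open>The inequality of Gagliardo for the line integrals \<open>F\<^sub>i\<close> of a single function \<open>f\<close> of \<open>n = m + 2\<close> variables:
  \<open>\<integral> \<Prod>\<^sub>i F\<^sub>i\<^bsup>1/(n-1)\<^esup> \<le> (\<integral> f)\<^bsup>n/(n-1)\<^esup>\<close>. For \<open>n = 2\<close> it is an equality, since each of the two line integrals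
  depends only on the other variable. To add a variable \<open>k\<close> to the set \<open>J\<close>, of cardinality \<open>n\<close>, put
  \<open>\<theta> = 1/n\<close>. On a slice where the new variable is fixed, Hoelder's inequality with weights \<open>1 - \<theta>\<close>
  and \<open>\<theta>\<close> separates \<open>F\<^sub>k\<close>, which does not depend on \<open>k\<close> and has integral \<open>\<integral> f\<close>, from the other factors.
  Since \<open>\<theta> = (1 - \<theta>) / (n - 1)\<close>, the induction hypothesis applies to these for the
  slice of \<open>f\<close>, and since \<open>n/(n-1) * (1 - \<theta>) = 1\<close> it bounds them by the integral of that
  slice to the first power, which is what can be integrated over \<open>k\<close>.\<close>

lemma integral_prod_line_integrals_le:
  assumes "finite J" "card J = Suc (Suc m)" "bounded_nonneg (PiM J M) f"
  shows "(\<integral>x. (\<Prod>i\<in>J. (\<integral>s. f (x(i := s)) \<partial>M i) powr (1 / Suc m)) \<partial>PiM J M)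
           \<le> (\<integral>x. f x \<partial>PiM J M) powr (1 + 1 / Suc m)"
  using assms
proof (induction m arbitrary: J f)
  case (0 J f)
  then obtain i k where J: "J = insert k {i}" and "k \<noteq> i"
    by (auto simp: card_2_iff numeral_2_eq_2[symmetric])
  let ?P = "PiM (insert k {i}) M"
  note f = 0(3)[unfolded J]
  define F where "F x = (\<integral>s. f (x(k := s)) \<partial>M k)" for x
  define E where "E x = (\<integral>s. f (x(i := s)) \<partial>M i)" for x
  have F_bn: "bounded_nonneg ?P F" "bounded_nonneg ?P E"
    unfolding F_def E_def using f by (auto intro!: bounded_nonneg_line_integral simp: insert_commute)
  have S: "(\<integral>x. f x \<partial>?P) = (\<integral>x. F x \<partial>PiM {i} M)"
    unfolding F_def using f \<open>k \<noteq> i\<close>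
    by (intro product_integral_insert bounded_nonneg_integrable finite_measure_PiM) auto
  have nn: "0 \<le> (\<integral>x. f x \<partial>?P)"
    using f by (auto intro!: Bochner_Integration.integral_nonneg simp: bounded_nonneg_nonneg)
  have "(\<integral>x. F x * E x \<partial>?P) \<le> (\<integral>x. f x \<partial>?P) * (\<integral>x. f x \<partial>?P)"
  proof (rule integral_le_by_slices[OF _ _ f bounded_nonneg_mult[OF F_bn]])
    fix t assume t: "t \<in> space (M k)"
    let ?c = "\<integral>x. f (x(k := t)) \<partial>PiM {i} M"
    \<comment> \<open>\<open>E\<close> does not depend on coordinate \<open>i\<close>, the only one that varies on this slice.\<close>
    have E: "E (x(k := t)) = ?c" if x: "x \<in> space (PiM {i} M)" for x
    proof -
      have "(\<lambda>s. f ((\<lambda>j\<in>{i}. s)(k := t))) \<in> borel_measurable (M i)"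
        by (rule measurable_compose[OF _ bounded_nonneg_measurable[OF bounded_nonneg_slice[OF f t]]])
           (auto intro!: measurable_restrict)
      then have "(\<integral>x. f ((\<lambda>j\<in>{i}. x i)(k := t)) \<partial>PiM {i} M) = (\<integral>s. f ((\<lambda>j\<in>{i}. s)(k := t)) \<partial>M i)"
        by (rule product_integral_singleton)
      moreover have "(\<integral>x. f ((\<lambda>j\<in>{i}. x i)(k := t)) \<partial>PiM {i} M) = ?c"
        by (intro Bochner_Integration.integral_cong refl arg_cong[where f = f])
           (auto simp: space_PiM PiE_def extensional_def restrict_def fun_eq_iff)
      moreover have "E (x(k := t)) = (\<integral>s. f ((\<lambda>j\<in>{i}. s)(k := t)) \<partial>M i)"
        unfolding E_def using x \<open>k \<noteq> i\<close>
        by (intro Bochner_Integration.integral_cong refl arg_cong[where f = f])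
           (auto simp: space_PiM PiE_def extensional_def restrict_def fun_eq_iff)
      ultimately show ?thesis by simp
    qed
    have "(\<integral>x. F (x(k := t)) * E (x(k := t)) \<partial>PiM {i} M) = (\<integral>x. F x * ?c \<partial>PiM {i} M)"
      by (intro Bochner_Integration.integral_cong refl) (simp add: E F_def)
    then show "(\<integral>x. F (x(k := t)) * E (x(k := t)) \<partial>PiM {i} M) \<le> ?c * (\<integral>x. f x \<partial>?P)"
      by (simp add: S)
  qed (use \<open>k \<noteq> i\<close> in auto)
  moreover have "(\<integral>x. (\<Prod>j\<in>J. (\<integral>s. f (x(j := s)) \<partial>M j) powr (1 / Suc 0)) \<partial>PiM J M)
       = (\<integral>x. F x * E x \<partial>?P)"
    unfolding J using \<open>k \<noteq> i\<close> F_bn[THEN bounded_nonneg_nonneg]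
    by (intro Bochner_Integration.integral_cong refl) (simp add: F_def E_def)
  moreover have "(\<integral>x. f x \<partial>PiM J M) powr (1 + 1 / Suc 0) = (\<integral>x. f x \<partial>?P) * (\<integral>x. f x \<partial>?P)"
    using nn by (simp add: J powr_numeral power2_eq_square)
  ultimately show ?case by (simp only:)
next
  case (Suc m J' f)
  then obtain k J where J': "J' = insert k J" "k \<notin> J" "card J = Suc (Suc m)"
    by (metis card_Suc_eq)
  then have J: "finite J" using Suc.prems by auto
  let ?P = "PiM (insert k J) M"
  note f = Suc.prems(3)[unfolded J'(1)]
  define \<theta> where "\<theta> = 1 / Suc (Suc m)"
  have \<theta>: "0 < \<theta>" "\<theta> < 1" "(1 - \<theta>) / Suc m = \<theta>" "(1 + 1 / Suc m) * (1 - \<theta>) = 1"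
    by (auto simp: \<theta>_def field_simps add_nonneg_eq_0_iff)
  define F where "F i x = (\<integral>s. f (x(i := s)) \<partial>M i)" for i x
  have F_bn: "bounded_nonneg ?P (F i)" if "i \<in> insert k J" for i
  proof -
    have "insert i (insert k J) = insert k J" using that by auto
    then show ?thesis
      unfolding F_def using f by (intro bounded_nonneg_line_integral) simp
  qed
  have Fk: "bounded_nonneg (PiM J M) (F k)"
    unfolding F_def by (rule bounded_nonneg_line_integral[OF f])
  have S: "(\<integral>x. f x \<partial>?P) = (\<integral>x. F k x \<partial>PiM J M)"
    unfolding F_def using f J J'
    by (intro product_integral_insert bounded_nonneg_integrable finite_measure_PiM) auto
  have nn: "0 \<le> (\<integral>x. f x \<partial>?P)"
    using f by (auto intro!: Bochner_Integration.integral_nonneg simp: bounded_nonneg_nonneg)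
  have "(\<integral>x. (\<Prod>i\<in>insert k J. F i x powr \<theta>) \<partial>?P) \<le> (\<integral>x. f x \<partial>?P) * (\<integral>x. f x \<partial>?P) powr \<theta>"
  proof (rule integral_le_by_slices[OF J J'(2) f])
    show "bounded_nonneg ?P (\<lambda>x. \<Prod>i\<in>insert k J. F i x powr \<theta>)"
      using \<theta> by (intro bounded_nonneg_prod bounded_nonneg_powr F_bn) auto
  next
    fix t assume t: "t \<in> space (M k)"
    define g where "g x = f (x(k := t))" for x
    have g: "bounded_nonneg (PiM J M) g"
      unfolding g_def by (rule bounded_nonneg_slice[OF f t])
    define H where "H x = (\<Prod>i\<in>J. (\<integral>s. g (x(i := s)) \<partial>M i) powr (1 / Suc m))" for x
    have H: "bounded_nonneg (PiM J M) H"
      unfolding H_def using g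
      by (intro bounded_nonneg_prod bounded_nonneg_powr bounded_nonneg_line_integral)
         (auto simp: insert_absorb)
    have split: "(\<Prod>i\<in>insert k J. F i (x(k := t)) powr \<theta>) = H x powr (1 - \<theta>) * F k x powr \<theta>" for x
    proof -
      have "F i (x(k := t)) = (\<integral>s. g (x(i := s)) \<partial>M i)" if "i \<in> J" for i
        using that J' unfolding F_def g_def by (metis fun_upd_twist)
      then have "(\<Prod>i\<in>J. F i (x(k := t)) powr \<theta>) = H x powr (1 - \<theta>)"
        unfolding H_def by (simp add: powr_powr \<theta> flip: prod_powr_distrib del: of_nat_Suc)
      moreover have "F k (x(k := t)) = F k x" by (simp add: F_def)
      ultimately show ?thesis using J J' by simp
    qed
    have IH: "(\<integral>x. H x \<partial>PiM J M) \<le> (\<integral>x. g x \<partial>PiM J M) powr (1 + 1 / Suc m)"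
      unfolding H_def by (rule Suc.IH[OF J J'(3) g])
    have "(\<integral>x. H x powr (1 - \<theta>) * F k x powr \<theta> \<partial>PiM J M)
        \<le> (\<integral>x. H x \<partial>PiM J M) powr (1 - \<theta>) * (\<integral>x. F k x \<partial>PiM J M) powr \<theta>"
      using \<theta> J
      by (intro Holder_powr bounded_nonneg_integrable finite_measure_PiM
          bounded_nonneg_nonneg[OF H] bounded_nonneg_nonneg[OF Fk] H Fk)
    also have "\<dots> \<le> ((\<integral>x. g x \<partial>PiM J M) powr (1 + 1 / Suc m)) powr (1 - \<theta>) * (\<integral>x. F k x \<partial>PiM J M) powr \<theta>"
      using IH \<theta> bounded_nonneg_nonneg[OF H]
      by (intro mult_right_mono powr_mono2 Bochner_Integration.integral_nonneg) auto
    also have "((\<integral>x. g x \<partial>PiM J M) powr (1 + 1 / Suc m)) powr (1 - \<theta>) = (\<integral>x. g x \<partial>PiM J M)"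
      unfolding powr_powr \<theta>(4)
      using bounded_nonneg_nonneg[OF g] by (intro powr_one Bochner_Integration.integral_nonneg) auto
    finally show "(\<integral>x. (\<Prod>i\<in>insert k J. F i (x(k := t)) powr \<theta>) \<partial>PiM J M)
        \<le> (\<integral>x. f (x(k := t)) \<partial>PiM J M) * (\<integral>x. f x \<partial>?P) powr \<theta>"
      by (simp add: split S g_def)
  qed
  also have "\<dots> = (\<integral>x. f x \<partial>?P) powr (1 + \<theta>)"
    using nn by (simp add: powr_add)
  finally show ?case unfolding J'(1) F_def \<theta>_def .
qed

end

section \<open>Euclidean space in coordinates, restricted to a cube\<close>

definition interval_lborel :: "real \<Rightarrow> real measure" where
  "interval_lborel R = density lborel (\<lambda>x. ennreal (indicator {-R..R} x))"

lemma space_interval_lborel [simp]: "space (interval_lborel R) = UNIV"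
  and sets_interval_lborel [simp, measurable_cong]: "sets (interval_lborel R) = sets borel"
  by (auto simp: interval_lborel_def)

lemma emeasure_interval_lborel:
  "A \<in> sets borel \<Longrightarrow> emeasure (interval_lborel R) A = emeasure lborel (A \<inter> {-R..R})"
  unfolding interval_lborel_def
  by (subst emeasure_density)
     (auto simp: ennreal_indicator Int_commute mult.commute simp flip: indicator_inter_arith)

lemma integral_interval_lborel:
  fixes f :: "real \<Rightarrow> real"
  assumes "f \<in> borel_measurable borel"
  shows "(\<integral>s. f s \<partial>interval_lborel R) = (\<integral>s. f s * indicator {-R..R} s \<partial>lborel)"
  unfolding interval_lborel_def using assms
  by (subst integral_density) (auto simp: mult.commute)

lemma finite_measure_family_interval: "finite_measure_family (\<lambda>_. interval_lborel R)"
proof (rule finite_measure_family.intro, rule finite_measureI)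
  have "emeasure (interval_lborel R) UNIV = emeasure lborel {-R..R}"
    by (simp add: emeasure_interval_lborel)
  then show "emeasure (interval_lborel R) (space (interval_lborel R)) \<noteq> \<infinity>"
    by (simp add: emeasure_lborel_Icc_eq)
qed

definition of_coords :: "('a \<Rightarrow> real) \<Rightarrow> 'a::euclidean_space" where
  "of_coords y = (\<Sum>b\<in>Basis. y b *\<^sub>R b)"

lemma of_coords_inner [simp]: "b \<in> Basis \<Longrightarrow> of_coords y \<bullet> b = y b"
  unfolding of_coords_def by simp

lemma of_coords_upd:
  assumes "b \<in> Basis"
  shows "of_coords (y(b := s)) = of_coords y + (s - y b) *\<^sub>R b"
proof (rule euclidean_eqI)
  fix c :: 'a assume "c \<in> Basis"
  then show "of_coords (y(b := s)) \<bullet> c = (of_coords y + (s - y b) *\<^sub>R b) \<bullet> c"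
    using assms by (cases "c = b") (simp_all add: inner_add_left inner_not_same_Basis)
qed

lemma measurable_of_coords [measurable]:
  "of_coords \<in> borel_measurable (PiM Basis (\<lambda>_. interval_lborel R))"
  unfolding of_coords_def by measurable

lemma PiM_interval_lborel:
  fixes I :: "'i set"
  assumes "finite I"
  shows "PiM I (\<lambda>_. interval_lborel R)
    = density (PiM I (\<lambda>_. lborel)) (\<lambda>y. ennreal (indicator (PiE I (\<lambda>_. {-R..R})) y))"
proof -
  interpret finite_measure_family "\<lambda>_::'i. interval_lborel R" by (rule finite_measure_family_interval)
  interpret L: product_sigma_finite "\<lambda>_::'i. lborel :: real measure" by standard
  have box [measurable]: "PiE I (\<lambda>_. {-R..R}) \<in> sets (PiM I (\<lambda>_. lborel))"
    using assms by (intro sets_PiM_I_finite) auto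
  show ?thesis
  proof (rule PiM_eqI[symmetric, OF assms])
    show "sets (density (PiM I (\<lambda>_. lborel)) (\<lambda>y. ennreal (indicator (PiE I (\<lambda>_. {-R..R})) y)))
       = sets (PiM I (\<lambda>_. interval_lborel R))"
      by (simp cong: sets_PiM_cong)
  next
    fix A :: "'i \<Rightarrow> real set" assume A: "\<And>i. i \<in> I \<Longrightarrow> A i \<in> sets (interval_lborel R)"
    then have "PiE I A \<in> sets (PiM I (\<lambda>_. lborel))"
      using assms by (intro sets_PiM_I_finite) auto
    then have "emeasure (density (PiM I (\<lambda>_. lborel)) (\<lambda>y. ennreal (indicator (PiE I (\<lambda>_. {-R..R})) y))) (PiE I A)
        = emeasure (PiM I (\<lambda>_. lborel)) (PiE I (\<lambda>i. A i \<inter> {-R..R}))"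
      by (subst emeasure_density)
         (auto simp: ennreal_indicator PiE_Int[symmetric] Int_commute nn_integral_indicator mult.commute
           simp flip: indicator_inter_arith)
    also have "\<dots> = (\<Prod>i\<in>I. emeasure (interval_lborel R) (A i))"
      using A assms by (subst L.emeasure_PiM) (auto simp: emeasure_interval_lborel intro!: prod.cong)
    finally show "emeasure (density (PiM I (\<lambda>_. lborel)) (\<lambda>y. ennreal (indicator (PiE I (\<lambda>_. {-R..R})) y))) (PiE I A)
        = (\<Prod>i\<in>I. emeasure (interval_lborel R) (A i))" .
  qed
qed

text \<open>Replacing Lebesgue measure by a product of finite measures is what makes the results on
  line integrals of bounded functions applicable. Cutting off to the cube costs nothing for functions
  supported in it.\<close>

lemma integral_of_coords:
  fixes u :: "'a::euclidean_space \<Rightarrow> real"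
  assumes [measurable]: "u \<in> borel_measurable borel"
    and supp: "\<And>x b. b \<in> Basis \<Longrightarrow> \<bar>x \<bullet> b\<bar> > R \<Longrightarrow> u x = 0"
  shows "(\<integral>x. u x \<partial>lborel) = (\<integral>y. u (of_coords y) \<partial>PiM Basis (\<lambda>_. interval_lborel R))"
proof -
  let ?L = "PiM (Basis :: 'a set) (\<lambda>_. lborel :: real measure)"
  let ?box = "PiE (Basis :: 'a set) (\<lambda>_. {-R..R})"
  have [measurable]: "of_coords \<in> borel_measurable ?L"
    unfolding of_coords_def by measurable
  have box [measurable]: "?box \<in> sets ?L"
    by (intro sets_PiM_I_finite) auto
  have "(\<integral>x. u x \<partial>lborel) = (\<integral>y. u (of_coords y) \<partial>?L)"
    by (subst lborel_eq) (simp add: integral_distr flip: of_coords_def)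
  also have "\<dots> = (\<integral>y. indicator ?box y * u (of_coords y) \<partial>?L)"
  proof (intro Bochner_Integration.integral_cong refl)
    fix y assume "y \<in> space ?L"
    then have y: "y \<in> extensional Basis" by (auto simp: space_PiM PiE_def)
    show "u (of_coords y) = indicator ?box y * u (of_coords y)"
    proof (cases "y \<in> ?box")
      case False
      then obtain b where "b \<in> Basis" "\<bar>y b\<bar> > R" using y by (auto simp: PiE_def Pi_def abs_real_def)
      then show ?thesis using supp[of b "of_coords y"] by simp
    qed simp
  qed
  also have "\<dots> = (\<integral>y. u (of_coords y) \<partial>PiM Basis (\<lambda>_. interval_lborel R))"
    by (subst PiM_interval_lborel) (auto simp: integral_density)
  finally show ?thesis .
qed

section \<open>The Sobolev inequality for continuously differentiable functions of compact support\<close>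

text \<open>The fundamental theorem of calculus on \<open>[-R, t]\<close>, from an endpoint where the function vanishes.\<close>

lemma abs_le_line_integral:
  fixes \<phi> :: "real \<Rightarrow> real"
  assumes deriv: "\<And>s. (\<phi> has_real_derivative \<phi>' s) (at s)"
    and cont: "continuous_on UNIV \<phi>'"
    and supp: "\<And>s. \<bar>s\<bar> \<ge> R \<Longrightarrow> \<phi> s = 0"
    and dom: "continuous_on UNIV \<psi>" "\<And>s. \<bar>\<phi>' s\<bar> \<le> \<psi> s"
  shows "\<bar>\<phi> t\<bar> \<le> (\<integral>s. \<psi> s \<partial>interval_lborel R)"
proof -
  have meas: "\<psi> \<in> borel_measurable borel"
    using dom by (auto intro: borel_measurable_continuous_onI)
  have \<psi>: "0 \<le> \<psi> s" for s using dom(2)[of s] by linarith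
  have int: "integrable lborel (\<lambda>s. \<eta> s * indicator {a..b} s)"
    if "continuous_on UNIV \<eta>" for \<eta> :: "real \<Rightarrow> real" and a b
    using borel_integrable_atLeastAtMost'[OF continuous_on_subset[OF that], of a b]
    by (simp add: set_integrable_def mult.commute)
  show ?thesis
  proof (cases "\<bar>t\<bar> < R")
    case False
    then show ?thesis
      using supp[of t] \<psi> by (auto intro!: Bochner_Integration.integral_nonneg)
  next
    case True
    have "\<phi> t = \<phi> t - \<phi> (-R)" using supp[of "-R"] by simp
    also have "\<dots> = (\<integral>s. \<phi>' s * indicator {-R..t} s \<partial>lborel)"
      using True deriv cont
      by (intro integral_FTC_Icc_real[symmetric]) (auto simp: continuous_on_eq_continuous_at)
    finally have "\<bar>\<phi> t\<bar> \<le> (\<integral>s. \<bar>\<phi>' s * indicator {-R..t} s\<bar> \<partial>lborel)"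
      using integral_abs_bound by metis
    also have "\<dots> \<le> (\<integral>s. \<psi> s * indicator {-R..R} s \<partial>lborel)"
      using True \<psi> dom
      by (intro integral_mono integrable_abs int cont) (auto split: split_indicator)
    finally show ?thesis by (simp add: integral_interval_lborel meas)
  qed
qed

lemma bounded_nonneg_continuous:
  fixes g :: "'a::euclidean_space \<Rightarrow> real"
  assumes "continuous_on UNIV g" "\<And>x. 0 \<le> g x" "\<And>x. r < norm x \<Longrightarrow> g x = 0"
  shows "bounded_nonneg borel g"
proof -
  have "compact (g ` cball 0 r)"
    using assms(1) by (intro compact_continuous_image) (auto intro: continuous_on_subset)
  then obtain B where B: "\<forall>y\<in>g ` cball 0 r. norm y \<le> B"
    using compact_imp_bounded bounded_iff by blast
  have "g x \<le> max B 0" for x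
  proof (cases "r < norm x")
    case False
    then have "norm (g x) \<le> B" using B by (intro B[rule_format] imageI) simp
    then show ?thesis by simp
  qed (simp add: assms(3))
  then show ?thesis
    using assms by (intro bounded_nonnegI[where B = "max B 0"]) (auto intro: borel_measurable_continuous_onI)
qed

lemma derivative_eq_0_outside:
  fixes v :: "'a::real_normed_vector \<Rightarrow> real"
  assumes "(v has_derivative v') (at x)" "\<And>x. r < norm x \<Longrightarrow> v x = 0" "r < norm x"
  shows "v' h = 0"
proof -
  have "open {x::'a. r < norm x}"
    by (intro open_Collect_less continuous_intros)
  then have "((\<lambda>_. 0) has_derivative v') (at x)"
    using assms by (intro has_derivative_transform_within_open[OF assms(1)]) auto
  then have "v' = (\<lambda>_. 0)"
    using has_derivative_unique has_derivative_const by blast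
  then show ?thesis by simp
qed

text \<open>The case \<open>p = 1\<close>. By the fundamental theorem of calculus \<open>\<bar>v\<bar>\<close> is at most the integral of
  \<open>\<Sum>\<^sub>b \<bar>\<partial>\<^sub>b v\<bar>\<close> along every line parallel to an axis. The \<open>n\<close>-th power of \<open>\<bar>v\<bar>\<^bsup>1/(n-1)\<^esup>\<close> is therefore
  bounded by the product of the \<open>n\<close> line integrals to the power \<open>1/(n-1)\<close>, and Gagliardo's inequality applies.
  The partial derivatives are merely continuous because the case of general \<open>p\<close>
  applies this to \<open>\<bar>u\<bar>\<^bsup>\<gamma>\<^esup>\<close>, which need not be smooth for smooth \<open>u\<close>.\<close>

lemma Sobolev_L1:
  fixes v :: "'a::euclidean_space \<Rightarrow> real"
  assumes dim: "DIM('a) \<ge> 2"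
    and deriv: "\<And>x. (v has_derivative v' x) (at x)"
    and cont: "\<And>b. b \<in> Basis \<Longrightarrow> continuous_on UNIV (\<lambda>x. v' x b)"
    and supp: "\<And>x. r < norm x \<Longrightarrow> v x = 0"
  shows "(\<integral>x. \<bar>v x\<bar> powr (real DIM('a) / (real DIM('a) - 1)) \<partial>lborel)
           \<le> (\<integral>x. (\<Sum>b\<in>Basis. \<bar>v' x b\<bar>) \<partial>lborel) powr (real DIM('a) / (real DIM('a) - 1))"
proof -
  obtain m where m: "DIM('a) = Suc (Suc m)"
    using dim by (metis Suc_diff_le Suc_1 add_2_eq_Suc le_Suc_ex)
  define e where "e = 1 / Suc m"
  have e: "0 < e" "real DIM('a) / (real DIM('a) - 1) = 1 + e" "real DIM('a) * e = 1 + e"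
    by (auto simp: m e_def field_simps)
  \<comment> \<open>The margin 1 makes \<open>v\<close> vanish on the faces of the cube, where the line integrals start.\<close>
  define R where "R = \<bar>r\<bar> + 1"
  define g where "g x = (\<Sum>b\<in>Basis. \<bar>v' x b\<bar>)" for x
  have outside: "r < norm x" if "b \<in> Basis" "R \<le> \<bar>x \<bullet> b\<bar>" for x b :: 'a
    using Basis_le_norm[OF that(1), of x] that(2) by (simp add: R_def)
  have g_supp: "g x = 0" if "r < norm x" for x
    unfolding g_def using derivative_eq_0_outside[OF deriv supp that] by simp
  have v_cont: "continuous_on UNIV v"
    using has_derivative_continuous[OF deriv] by (simp add: continuous_on_eq_continuous_at)
  have g_cont: "continuous_on UNIV g"
    unfolding g_def using cont by (intro continuous_intros)
  have v_bn: "bounded_nonneg borel (\<lambda>x. \<bar>v x\<bar>)"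
    using supp by (intro bounded_nonneg_continuous[where r = r] continuous_intros v_cont) auto
  have g_bn: "bounded_nonneg borel g"
    by (rule bounded_nonneg_continuous[OF g_cont _ g_supp]) (auto simp: g_def intro!: sum_nonneg)
  interpret finite_measure_family "\<lambda>_::'a. interval_lborel R" by (rule finite_measure_family_interval)
  let ?P = "PiM (Basis :: 'a set) (\<lambda>_. interval_lborel R)"
  define f where "f y = g (of_coords y)" for y
  have f_bn: "bounded_nonneg ?P f"
    unfolding f_def by (rule bounded_nonneg_compose[OF g_bn measurable_of_coords])
  have line: "\<bar>v (of_coords y)\<bar> \<le> (\<integral>s. f (y(b := s)) \<partial>interval_lborel R)" if b: "b \<in> Basis" for y b
  proof -
    define z where "z = of_coords (y(b := 0))"
    have line: "of_coords (y(b := s)) = z + s *\<^sub>R b" for s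
      unfolding z_def of_coords_upd[OF b] by (simp add: scaleR_left_diff_distrib)
    have "\<bar>v (z + y b *\<^sub>R b)\<bar> \<le> (\<integral>s. g (z + s *\<^sub>R b) \<partial>interval_lborel R)"
    proof (rule abs_le_line_integral[where \<phi> = "\<lambda>s. v (z + s *\<^sub>R b)"
          and \<phi>' = "\<lambda>s. v' (z + s *\<^sub>R b) b" and R = R])
      fix s :: real
      have "((\<lambda>s. v (z + s *\<^sub>R b)) has_derivative (\<lambda>h. v' (z + s *\<^sub>R b) (h *\<^sub>R b))) (at s)"
        by (rule has_derivative_compose[OF _ deriv]) (auto intro!: derivative_eq_intros)
      moreover have "v' (z + s *\<^sub>R b) (h *\<^sub>R b) = v' (z + s *\<^sub>R b) b * h" for h
        using linear_cmul[OF has_derivative_linear[OF deriv]] by simp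
      ultimately show "((\<lambda>s. v (z + s *\<^sub>R b)) has_real_derivative v' (z + s *\<^sub>R b) b) (at s)"
        by (simp add: has_field_derivative_def)
      show "\<bar>v' (z + s *\<^sub>R b) b\<bar> \<le> g (z + s *\<^sub>R b)"
        unfolding g_def using b member_le_sum[of b Basis "\<lambda>c. \<bar>v' (z + s *\<^sub>R b) c\<bar>"] by auto
      show "v (z + s *\<^sub>R b) = 0" if "R \<le> \<bar>s\<bar>"
      proof (rule supp, rule outside[OF b])
        have "(z + s *\<^sub>R b) \<bullet> b = s" using of_coords_inner[OF b, of "y(b := s)"] by (simp add: line)
        then show "R \<le> \<bar>(z + s *\<^sub>R b) \<bullet> b\<bar>" using that by simp
      qed
    next
      show "continuous_on UNIV (\<lambda>s. v' (z + s *\<^sub>R b) b)"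
        by (rule continuous_on_compose2[OF cont[OF b]]) (auto intro!: continuous_intros)
      show "continuous_on UNIV (\<lambda>s. g (z + s *\<^sub>R b))"
        by (rule continuous_on_compose2[OF g_cont]) (auto intro!: continuous_intros)
    qed
    moreover have "of_coords y = z + y b *\<^sub>R b" using line[of "y b"] by simp
    ultimately show ?thesis by (simp add: f_def line)
  qed
  have "(\<integral>x. \<bar>v x\<bar> powr (1 + e) \<partial>lborel) = (\<integral>y. \<bar>v (of_coords y)\<bar> powr (1 + e) \<partial>?P)"
  proof (rule integral_of_coords)
    have [measurable]: "v \<in> borel_measurable borel" by (rule borel_measurable_continuous_onI[OF v_cont])
    show "(\<lambda>x. \<bar>v x\<bar> powr (1 + e)) \<in> borel_measurable borel" by measurable
  qed (use outside supp in \<open>auto intro: less_imp_le\<close>)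
  also have "\<dots> \<le> (\<integral>y. (\<Prod>b\<in>Basis. (\<integral>s. f (y(b := s)) \<partial>interval_lborel R) powr e) \<partial>?P)"
  proof (intro integral_mono bounded_nonneg_integrable[OF finite_measure_PiM])
    show "bounded_nonneg ?P (\<lambda>y. \<bar>v (of_coords y)\<bar> powr (1 + e))"
      using e by (intro bounded_nonneg_powr bounded_nonneg_compose[OF v_bn measurable_of_coords]) auto
    show "bounded_nonneg ?P (\<lambda>y. \<Prod>b\<in>Basis. (\<integral>s. f (y(b := s)) \<partial>interval_lborel R) powr e)"
      using e f_bn by (intro bounded_nonneg_prod bounded_nonneg_powr bounded_nonneg_line_integral) (auto simp: insert_absorb)
    fix y assume "y \<in> space ?P"
    have "\<bar>v (of_coords y)\<bar> powr (1 + e) = (\<Prod>b\<in>(Basis::'a set). \<bar>v (of_coords y)\<bar> powr e)"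
      by (cases "v (of_coords y) = 0") (auto simp: powr_powr mult.commute e(3)[symmetric] simp flip: powr_realpow)
    also have "\<dots> \<le> (\<Prod>b\<in>Basis. (\<integral>s. f (y(b := s)) \<partial>interval_lborel R) powr e)"
      using e by (intro prod_mono conjI powr_mono2 line) auto
    finally show "\<bar>v (of_coords y)\<bar> powr (1 + e) \<le> (\<Prod>b\<in>Basis. (\<integral>s. f (y(b := s)) \<partial>interval_lborel R) powr e)" .
  qed auto
  also have "\<dots> \<le> (\<integral>y. f y \<partial>?P) powr (1 + e)"
    unfolding e_def by (rule integral_prod_line_integrals_le[OF _ m f_bn]) simp
  also have "(\<integral>y. f y \<partial>?P) = (\<integral>x. g x \<partial>lborel)"
    unfolding f_def using g_supp outside bounded_nonneg_measurable[OF g_bn]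
    by (intro integral_of_coords[symmetric]) (auto intro: less_imp_le)
  finally show ?thesis by (simp only: e g_def)
qed

lemma has_real_derivative_abs_powr:
  fixes t :: real
  assumes "1 < \<gamma>"
  shows "((\<lambda>t. \<bar>t\<bar> powr \<gamma>) has_real_derivative \<gamma> * \<bar>t\<bar> powr (\<gamma> - 1) * sgn t) (at t)"
proof (cases "t = 0")
  case True
  have "((\<lambda>h. \<bar>h\<bar> powr (\<gamma> - 1) * sgn h) \<longlongrightarrow> 0) (at (0::real))"
  proof (rule Lim_null_comparison)
    show "\<forall>\<^sub>F h in at 0. norm (\<bar>h\<bar> powr (\<gamma> - 1) * sgn h) \<le> \<bar>h::real\<bar> powr (\<gamma> - 1)"
      by (auto simp: abs_mult sgn_real_def)
    have "((\<lambda>h::real. \<bar>h\<bar> powr (\<gamma> - 1)) \<longlongrightarrow> \<bar>0\<bar> powr (\<gamma> - 1)) (at 0)"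
      using assms by (intro tendsto_powr' tendsto_intros) auto
    then show "((\<lambda>h::real. \<bar>h\<bar> powr (\<gamma> - 1)) \<longlongrightarrow> 0) (at 0)" by simp
  qed
  moreover have "\<bar>h\<bar> powr (\<gamma> - 1) * sgn h = \<bar>h\<bar> powr \<gamma> / h" if "h \<noteq> 0" for h :: real
    using that by (cases "h > 0") (auto simp: powr_diff)
  ultimately have "((\<lambda>h. \<bar>h\<bar> powr \<gamma> / h) \<longlongrightarrow> 0) (at (0::real))"
    by (subst (asm) tendsto_cong[where g = "\<lambda>h. \<bar>h\<bar> powr \<gamma> / h"]) (auto simp: eventually_at_filter)
  then show ?thesis using True by (simp add: DERIV_def)
next
  case False
  \<comment> \<open>Near \<open>t\<close> the sign is constant, so \<open>\<bar>x\<bar> = sgn t * x\<close>, which is differentiable in \<open>x\<close>.\<close>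
  have "((\<lambda>t. (sgn t0 * t) powr \<gamma>) has_real_derivative \<gamma> * \<bar>t\<bar> powr (\<gamma> - 1) * sgn t) (at t)"
    if "t0 = t" for t0
    using False that
    by (auto intro!: derivative_eq_intros simp: abs_sgn mult.commute[of t] sgn_real_def)
  from this[of t] show ?thesis
  proof (rule has_field_derivative_transform_within)
    show "\<bar>t\<bar> > 0" using False by simp
    fix x assume "dist x t < \<bar>t\<bar>"
    then show "(sgn t * x) powr \<gamma> = \<bar>x\<bar> powr \<gamma>"
      by (cases "t > 0"; cases "x > 0") (auto simp: dist_real_def sgn_real_def abs_real_def split: if_splits)
  qed auto
qed

lemma continuous_abs_powr_sgn:
  fixes a :: real
  assumes "0 < a"
  shows "continuous_on UNIV (\<lambda>t::real. \<bar>t\<bar> powr a * sgn t)"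
proof -
  have "\<bar>t\<bar> powr a * sgn t = (max t 0) powr a - (max (- t) 0) powr a" for t :: real
    using assms by (cases t "0::real" rule: linorder_cases) auto
  moreover have "continuous_on UNIV (\<lambda>t::real. (max t 0) powr a - (max (- t) 0) powr a)"
    using assms by (intro continuous_intros continuous_on_powr') auto
  ultimately show ?thesis by simp
qed

lemma integrable_continuous_compact_support:
  fixes g :: "'a::euclidean_space \<Rightarrow> real"
  assumes "continuous_on UNIV g" "\<And>x. r < norm x \<Longrightarrow> g x = 0"
  shows "integrable lborel g"
proof -
  have "integrable lborel (\<lambda>x. indicator (cball 0 r) x *\<^sub>R g x)"
    using assms(1) by (intro borel_integrable_compact) (auto intro: continuous_on_subset)
  also have "(\<lambda>x. indicator (cball 0 r) x *\<^sub>R g x) = g"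
    using assms(2) by (auto simp: fun_eq_iff indicator_def)
  finally show ?thesis .
qed

text \<open>
  For \<open>p > 1\<close> the \<open>L\<^sup>1\<close> inequality is applied to \<open>\<bar>u\<bar>\<^bsup>\<gamma>\<^esup>\<close>. The choice \<open>\<gamma> = p(d-1)/(d-p)\<close> makes the same
  power \<open>q = dp/(d-p)\<close> of \<open>\<bar>u\<bar>\<close> appear on both sides: on the left as \<open>(\<bar>u\<bar>\<^bsup>\<gamma>\<^esup>)\<^bsup>d/(d-1)\<^esup>\<close>, on the right as
  \<open>(\<bar>u\<bar>\<^bsup>\<gamma>-1\<^esup>)\<^bsup>p/(p-1)\<^esup>\<close> after Hoelder's inequality. With \<open>X = \<integral> \<bar>u\<bar>\<^bsup>q\<^esup>\<close> this reads
  \<open>X\<^bsup>(d-1)/d\<^esup> \<le> \<gamma> N X\<^bsup>1-1/p\<^esup>\<close>, where \<open>N\<close> is the sum of the \<open>L\<^sup>p\<close> norms of the partial derivatives; division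
  by the power on the right leaves \<open>X\<^bsup>1/q\<^esup>\<close>. The case \<open>p = 1\<close> is separate because
  \<open>\<bar>t\<bar>\<^bsup>\<gamma>\<^esup>\<close> is not differentiable at \<open>0\<close> for \<open>\<gamma> = 1\<close>.\<close>

theorem Gagliardo_Nirenberg_Sobolev:
  fixes u :: "'a::euclidean_space \<Rightarrow> real" and p :: real
  defines "d \<equiv> real DIM('a)"
  assumes dim: "DIM('a) \<ge> 2" and p: "1 \<le> p" "p < d"
    and deriv: "\<And>x. (u has_derivative u' x) (at x)"
    and cont: "\<And>b. b \<in> Basis \<Longrightarrow> continuous_on UNIV (\<lambda>x. u' x b)"
    and supp: "\<And>x. r < norm x \<Longrightarrow> u x = 0"
  shows "(\<integral>x. \<bar>u x\<bar> powr (d * p / (d - p)) \<partial>lborel) powr ((d - p) / (d * p))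
           \<le> p * (d - 1) / (d - p) * (\<Sum>b\<in>Basis. (\<integral>x. \<bar>u' x b\<bar> powr p \<partial>lborel) powr (1 / p))"
proof -
  have d: "d \<ge> 2" unfolding d_def using dim by simp
  have u'_supp: "u' x b = 0" if "r < norm x" for x b
    by (rule derivative_eq_0_outside[OF deriv supp that])
  have u_cont: "continuous_on UNIV u"
    using has_derivative_continuous[OF deriv] by (simp add: continuous_on_eq_continuous_at)
  define q where "q = d * p / (d - p)"
  define X where "X = (\<integral>x. \<bar>u x\<bar> powr q \<partial>lborel)"
  define N where "N = (\<Sum>b\<in>Basis. (\<integral>x. \<bar>u' x b\<bar> powr p \<partial>lborel) powr (1 / p))"
  have q: "(d - p) / (d * p) = 1 / q" "q > 0" using p d by (auto simp: q_def)
  have X: "X \<ge> 0" unfolding X_def by (intro Bochner_Integration.integral_nonneg) auto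
  have N: "N \<ge> 0" unfolding N_def by (intro sum_nonneg) auto
  have "X powr (1 / q) \<le> p * (d - 1) / (d - p) * N"
  proof (cases "p = 1")
    case True
    have "X \<le> (\<integral>x. (\<Sum>b\<in>Basis. \<bar>u' x b\<bar>) \<partial>lborel) powr q"
      using Sobolev_L1[OF dim deriv cont supp] True by (simp add: X_def q_def d_def)
    also have "(\<integral>x. (\<Sum>b\<in>Basis. \<bar>u' x b\<bar>) \<partial>lborel) = (\<Sum>b\<in>Basis. \<integral>x. \<bar>u' x b\<bar> \<partial>lborel)"
      using u'_supp
      by (intro Bochner_Integration.integral_sum integrable_continuous_compact_support[where r = r] continuous_intros cont) auto
    also have "\<dots> = N"
      unfolding N_def True by (intro sum.cong refl) (simp add: Bochner_Integration.integral_nonneg)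
    finally have "X powr (1 / q) \<le> (N powr q) powr (1 / q)"
      using X q by (intro powr_mono2) auto
    also have "\<dots> = N" using q N by (simp add: powr_powr)
    finally show ?thesis using True d by simp
  next
    case False
    then have p1: "p > 1" using p by simp
    define \<gamma> where "\<gamma> = p * (d - 1) / (d - p)"
    have \<gamma>: "\<gamma> > 1" using p1 p(2) d by (simp add: \<gamma>_def field_simps)
    have exps: "\<gamma> * (d / (d - 1)) = q" "q * (1 - 1 / p) = \<gamma> - 1" "(d - 1) / d - (1 - 1 / p) = 1 / q"
    proof -
      show "\<gamma> * (d / (d - 1)) = q" using d by (simp add: \<gamma>_def q_def)
    qed (use p1 p(2) d in \<open>auto simp: \<gamma>_def q_def field_simps\<close>)
    define v where "v x = \<bar>u x\<bar> powr \<gamma>" for x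
    define v' where "v' x h = \<gamma> * \<bar>u x\<bar> powr (\<gamma> - 1) * sgn (u x) * u' x h" for x h
    have v_deriv: "(v has_derivative v' x) (at x)" for x
    proof -
      have "((\<lambda>t. \<bar>t\<bar> powr \<gamma>) has_derivative (\<lambda>h. \<gamma> * \<bar>u x\<bar> powr (\<gamma> - 1) * sgn (u x) * h)) (at (u x))"
        using has_real_derivative_abs_powr[OF \<gamma>] by (simp add: has_field_derivative_def)
      from has_derivative_compose[OF deriv this] show ?thesis unfolding v_def v'_def .
    qed
    have v'_cont: "continuous_on UNIV (\<lambda>x. v' x b)" if "b \<in> Basis" for b
    proof -
      have "continuous_on UNIV (\<lambda>x. \<bar>u x\<bar> powr (\<gamma> - 1) * sgn (u x))"
        using \<gamma> by (intro continuous_on_compose2[OF continuous_abs_powr_sgn u_cont]) auto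
      then have "continuous_on UNIV (\<lambda>x. \<gamma> * (\<bar>u x\<bar> powr (\<gamma> - 1) * sgn (u x)) * u' x b)"
        by (rule continuous_on_mult[OF continuous_on_mult[OF continuous_on_const] cont[OF that]])
      then show ?thesis by (simp add: v'_def mult.assoc)
    qed
    have v_supp: "v x = 0" if "r < norm x" for x using supp[OF that] by (simp add: v_def)
    have v'_supp: "v' x b = 0" if "r < norm x" for x b using u'_supp[OF that] by (simp add: v'_def)
    have holder: "(\<integral>x. \<bar>v' x b\<bar> \<partial>lborel)
        \<le> \<gamma> * (X powr (1 - 1 / p) * (\<integral>x. \<bar>u' x b\<bar> powr p \<partial>lborel) powr (1 / p))"
      if b: "b \<in> Basis" for b
    proof -
      have "\<bar>v' x b\<bar> = \<gamma> * ((\<bar>u x\<bar> powr q) powr (1 - 1 / p) * (\<bar>u' x b\<bar> powr p) powr (1 / p))" for x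
        using p1 \<gamma> by (cases "u x = 0") (auto simp: v'_def powr_powr exps abs_mult abs_sgn_eq)
      then have "(\<integral>x. \<bar>v' x b\<bar> \<partial>lborel)
          = \<gamma> * (\<integral>x. (\<bar>u x\<bar> powr q) powr (1 - 1 / p) * (\<bar>u' x b\<bar> powr p) powr (1 / p) \<partial>lborel)"
        by simp
      also have "\<dots> \<le> \<gamma> * (X powr (1 - 1 / p) * (\<integral>x. \<bar>u' x b\<bar> powr p \<partial>lborel) powr (1 / p))"
        unfolding X_def
      proof (intro mult_left_mono Holder_powr)
        show "integrable lborel (\<lambda>x. \<bar>u x\<bar> powr q)" "integrable lborel (\<lambda>x. \<bar>u' x b\<bar> powr p)"
          using q p1 supp u'_supp
          by (auto intro!: integrable_continuous_compact_support[where r = r] continuous_on_powr'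
              continuous_on_rabs continuous_on_const u_cont cont b)
      qed (use p1 \<gamma> in auto)
      finally show ?thesis .
    qed
    have "X \<le> (\<integral>x. (\<Sum>b\<in>Basis. \<bar>v' x b\<bar>) \<partial>lborel) powr (d / (d - 1))"
      using Sobolev_L1[where r = r, OF dim v_deriv v'_cont v_supp] exps(1)
      by (simp add: X_def v_def powr_powr flip: d_def)
    also have "(\<integral>x. (\<Sum>b\<in>Basis. \<bar>v' x b\<bar>) \<partial>lborel) = (\<Sum>b\<in>Basis. \<integral>x. \<bar>v' x b\<bar> \<partial>lborel)"
      using v'_supp
      by (intro Bochner_Integration.integral_sum integrable_continuous_compact_support[where r = r] continuous_intros v'_cont) auto
    also have "(\<Sum>b\<in>Basis. \<integral>x. \<bar>v' x b\<bar> \<partial>lborel) powr (d / (d - 1))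
        \<le> (\<Sum>b\<in>Basis. \<gamma> * (X powr (1 - 1 / p) * (\<integral>x. \<bar>u' x b\<bar> powr p \<partial>lborel) powr (1 / p))) powr (d / (d - 1))"
      using d by (intro powr_mono2 sum_mono holder sum_nonneg Bochner_Integration.integral_nonneg) auto
    also have "(\<Sum>b\<in>Basis. \<gamma> * (X powr (1 - 1 / p) * (\<integral>x. \<bar>u' x b\<bar> powr p \<partial>lborel) powr (1 / p)))
        = \<gamma> * N * X powr (1 - 1 / p)"
      by (simp add: N_def sum_distrib_left sum_distrib_right mult_ac)
    finally have "X powr ((d - 1) / d) \<le> ((\<gamma> * N * X powr (1 - 1 / p)) powr (d / (d - 1))) powr ((d - 1) / d)"
      using X d by (intro powr_mono2) auto
    also have "\<dots> = \<gamma> * N * X powr (1 - 1 / p)"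
      using d \<gamma> N by (simp add: powr_powr)
    finally have main: "X powr ((d - 1) / d) \<le> \<gamma> * N * X powr (1 - 1 / p)" .
    show ?thesis
    proof (cases "X = 0")
      case True
      then show ?thesis using N p d by simp
    next
      case False
      then have "X powr (1 / q) = X powr ((d - 1) / d) / X powr (1 - 1 / p)"
        using exps(3) by (metis powr_diff)
      also have "\<dots> \<le> \<gamma> * N" using main False X by (simp add: pos_divide_le_eq)
      finally show ?thesis by (simp add: \<gamma>_def)
    qed
  qed
  then show ?thesis unfolding q X_def N_def q_def[symmetric] .
qed

section \<open>The hyperboloid\<close>

lemma hyp_weight_pos: "\<tau> > 0 \<Longrightarrow> hyp_weight \<tau> x > 0"
  unfolding hyp_weight_def by (simp add: add_pos_nonneg)

lemma measurable_hyp_weight [measurable]: "hyp_weight \<tau> \<in> borel_measurable borel"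
  unfolding hyp_weight_def by measurable

text \<open>The form \<open>\<tau> * g x\<close> of \<open>eq\<close>, free of the weight, is what the exponents \<open>1\<close> and
  \<open>1 - p\<close> of the two norms are made for.\<close>

lemma integral_hyp_vol:
  fixes f :: "real ^ 'n \<Rightarrow> real"
  assumes "\<tau> > 0" "f \<in> borel_measurable borel"
    and eq: "\<And>x. f x * (\<tau> / hyp_weight \<tau> x) = \<tau> * g x"
  shows "(\<integral>x. f x \<partial>hyp_vol \<tau>) = \<tau> * (\<integral>x. g x \<partial>lborel)"
  unfolding hyp_vol_def using assms hyp_weight_pos[OF assms(1)]
  by (subst integral_density)
     (auto intro!: AE_I2 divide_nonneg_pos simp: mult.commute simp flip: eq integral_mult_right_zero)

lemma Lp_norm_weight_1:
  fixes u :: "real ^ 'n \<Rightarrow> real"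
  assumes "\<tau> > 0" and [measurable]: "u \<in> borel_measurable borel"
  shows "Lp_norm \<tau> 1 q u = (\<tau> * (\<integral>x. \<bar>u x\<bar> powr q \<partial>lborel)) powr (1 / q)"
proof -
  have "(\<integral>x. hyp_weight \<tau> x powr 1 * \<bar>u x\<bar> powr q \<partial>hyp_vol \<tau>) = \<tau> * (\<integral>x. \<bar>u x\<bar> powr q \<partial>lborel)"
  proof (rule integral_hyp_vol[OF assms(1)])
    fix x :: "real ^ 'n"
    have "hyp_weight \<tau> x > 0" by (rule hyp_weight_pos[OF assms(1)])
    then show "hyp_weight \<tau> x powr 1 * \<bar>u x\<bar> powr q * (\<tau> / hyp_weight \<tau> x) = \<tau> * \<bar>u x\<bar> powr q"
      by simp
  qed measurable
  then show ?thesis by (simp add: Lp_norm_def)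
qed

lemma Lp_norm_boost:
  fixes u :: "real ^ 'n \<Rightarrow> real"
  assumes "\<tau> > 0" and [measurable]: "(\<lambda>x. frechet_derivative u (at x) (axis i 1)) \<in> borel_measurable borel"
  shows "Lp_norm \<tau> (1 - p) p (boost \<tau> i u)
    = (\<tau> * (\<integral>x. \<bar>frechet_derivative u (at x) (axis i 1)\<bar> powr p \<partial>lborel)) powr (1 / p)"
proof -
  have "(\<integral>x. hyp_weight \<tau> x powr (1 - p) * \<bar>boost \<tau> i u x\<bar> powr p \<partial>hyp_vol \<tau>)
      = \<tau> * (\<integral>x. \<bar>frechet_derivative u (at x) (axis i 1)\<bar> powr p \<partial>lborel)"
  proof (rule integral_hyp_vol[OF assms(1)])
    show "(\<lambda>x. hyp_weight \<tau> x powr (1 - p) * \<bar>boost \<tau> i u x\<bar> powr p) \<in> borel_measurable borel"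
      unfolding boost_def by measurable
    fix x :: "real ^ 'n"
    have w: "hyp_weight \<tau> x > 0" by (rule hyp_weight_pos[OF assms(1)])
    have "hyp_weight \<tau> x powr (1 - p) * hyp_weight \<tau> x powr p = hyp_weight \<tau> x"
      using w by (simp flip: powr_add)
    then show "hyp_weight \<tau> x powr (1 - p) * \<bar>boost \<tau> i u x\<bar> powr p * (\<tau> / hyp_weight \<tau> x)
        = \<tau> * \<bar>frechet_derivative u (at x) (axis i 1)\<bar> powr p"
      using w by (simp add: boost_def abs_mult powr_mult field_simps)
  qed
  then show ?thesis by (simp add: Lp_norm_def)
qed

theorem mainTheorem2:
  fixes p d :: real
  defines "d \<equiv> real CARD('n::finite)"
  assumes "CARD('n) \<ge> 2" and "1 \<le> p" and "p < d"
  shows "\<exists>C::real. \<forall>\<tau>>0. \<forall>u :: real ^ 'n \<Rightarrow> real. smooth u \<longrightarrow> compactly_supported u \<longrightarrow>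
    \<tau> powr (1 / d) * Lp_norm \<tau> 1 (d * p / (d - p)) u \<le> C * Wkp_homog_norm \<tau> (1 - p) 1 p u"
proof (intro exI allI impI)
  fix \<tau> :: real and u :: "real ^ 'n \<Rightarrow> real"
  assume \<tau>: "\<tau> > 0" and smooth: "smooth u" and supp: "compactly_supported u"
  define C where "C = p * (d - 1) / (d - p)"
  define q where "q = d * p / (d - p)"
  define X where "X = (\<integral>x. \<bar>u x\<bar> powr q \<partial>lborel)"
  define Y where "Y b = (\<integral>x. \<bar>frechet_derivative u (at x) b\<bar> powr p \<partial>lborel)" for b
  have d: "d > 0" using assms by simp
  have "Ck 1 u" using smooth by (simp add: smooth_def)
  then have deriv: "(u has_derivative frechet_derivative u (at x)) (at x)"
    and cont: "continuous_on UNIV (\<lambda>x. frechet_derivative u (at x) h)" for x h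
    by (auto simp: One_nat_def frechet_derivative_works)
  have u_cont: "continuous_on UNIV u"
    using has_derivative_continuous[OF deriv] by (simp add: continuous_on_eq_continuous_at)
  have "bounded (support_on UNIV u)"
    using supp bounded_subset[OF compact_imp_bounded closure_subset] by (auto simp: compactly_supported_def)
  then obtain r where "\<forall>x\<in>support_on UNIV u. norm x \<le> r" by (auto simp: bounded_iff)
  then have r: "u x = 0" if "r < norm x" for x
    using that by (force simp: support_on_def)
  have "X powr (1 / q) \<le> C * (\<Sum>b\<in>Basis. Y b powr (1 / p))"
    using Gagliardo_Nirenberg_Sobolev[of p u "\<lambda>x. frechet_derivative u (at x)" r] deriv cont r assms
    by (simp add: X_def Y_def C_def q_def)
  also have "(\<Sum>b\<in>Basis. Y b powr (1 / p)) = (\<Sum>i\<in>UNIV. Y (axis i 1) powr (1 / p))"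
  proof -
    have *: "(Basis :: (real ^ 'n) set) = range (\<lambda>i. axis i 1)" by (auto simp: Basis_vec_def)
    have "inj (\<lambda>i::'n. axis i (1::real))" by (auto simp: inj_def axis_eq_axis)
    then show ?thesis unfolding * by (subst sum.reindex) auto
  qed
  finally have GNS: "X powr (1 / q) \<le> C * (\<Sum>i\<in>UNIV. Y (axis i 1) powr (1 / p))" .
  have exps: "1 / d + 1 / q = 1 / p"
    using assms d by (simp add: q_def field_simps)
  have X: "X \<ge> 0" unfolding X_def by (intro Bochner_Integration.integral_nonneg) auto
  have Y: "Y b \<ge> 0" for b unfolding Y_def by (intro Bochner_Integration.integral_nonneg) auto
  have "\<tau> powr (1 / d) * Lp_norm \<tau> 1 q u = \<tau> powr (1 / d) * (\<tau> * X) powr (1 / q)"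
    using Lp_norm_weight_1[OF \<tau> borel_measurable_continuous_onI[OF u_cont]] by (simp add: X_def)
  also have "\<dots> = \<tau> powr (1 / p) * X powr (1 / q)"
    using \<tau> X by (simp add: powr_mult exps flip: powr_add mult.assoc)
  also have "\<dots> \<le> \<tau> powr (1 / p) * (C * (\<Sum>i\<in>UNIV. Y (axis i 1) powr (1 / p)))"
    by (intro mult_left_mono GNS) auto
  also have "\<dots> = C * (\<Sum>i\<in>UNIV. (\<tau> * Y (axis i 1)) powr (1 / p))"
    using \<tau> Y by (simp add: powr_mult sum_distrib_left mult_ac)
  also have "(\<Sum>i\<in>UNIV. (\<tau> * Y (axis i 1)) powr (1 / p)) = (\<Sum>i\<in>UNIV. Lp_norm \<tau> (1 - p) p (boost \<tau> i u))"
    using Lp_norm_boost[OF \<tau> borel_measurable_continuous_onI[OF cont]] by (simp add: Y_def)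
  also have "\<dots> = Wkp_homog_norm \<tau> (1 - p) 1 p u"
  proof -
    have "{js :: 'n list. length js = 1} = range (\<lambda>i. [i])"
      by (auto simp: length_Suc_conv)
    then show ?thesis
      by (simp add: Wkp_homog_norm_def sum.reindex inj_def)
  qed
  finally show "\<tau> powr (1 / d) * Lp_norm \<tau> 1 (d * p / (d - p)) u
      \<le> (p * (d - 1) / (d - p)) * Wkp_homog_norm \<tau> (1 - p) 1 p u"
    by (simp add: C_def q_def)
qed

end
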